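(* Let $q=4n+3$ be a prime with $n\ge 1$, and let $r=q+1$. Let $S,T,u_0,u_1,H_1,H_2,G_1,G_2$ be the sets, integers and graphs specified in the context. Then the amalgam graph $B^*_q(S,T,u_0,u_1)$ is an $(\{r,2r-5\};5)$-cage of order $r(2r-5)+1$.
   Context: All graphs are finite, undirected and simple. The girth of a graph is the length of a shortest cycle. For integers $2\le r<m$, an $(\{r,m\};g)$-graph is a graph of girth exactly $g$ whose set of vertex degrees is exactly $\{r,m\}$, and an $(\{r,m\};g)$-cage is an $(\{r,m\};g)$-graph of minimum possible order. Here $GF(q)=\mathbb Z_q$ (integers mod $q$), $\mathbb Z_q^*=\mathbb Z_q\setminus\{0\}$, and $\alpha$ is a fixed generator of the multiplicative group $\mathbb Z_q^*$. The graph $B_q$ is the bipartite graph with vertex classes $V_0=\{(x,y)_0: x,y\in\mathbb Z_q\}$ and $V_1=\{(m,b)_1: m,b\in\mathbb Z_q\}$, in which $(x,y)_0$ is adjacent to $(m,b)_1$ if and only if $y=mx+b$. For $x,m\in \mathbb Z_q$ put $P_x=\{(x,y)_0: y\in\mathbb Z_q\}$ and $L_m=\{(m,b)_1: b\in\mathbb Z_q\}$. General construction. For $T\subseteq S\subseteq\mathbb Z_q$ and integers $0\le u_0\le u_1<q-1$, let $U_i=\{\alpha^{q-j}: j=2,\dots,u_i+1\}$ for $i=0,1$ (empty if $u_i=0$). The graph $B_q(S,T,u_0,u_1)$ is obtained from $B_q$ by deleting the vertices $(0,y)_0$ with $y\in S$, the vertices $(0,b)_1$ with $b\in T$, all blocks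 $P_x$ with $x\in U_0$, and all blocks $L_m$ with $m\in U_1$. Given graphs $H_1,H_2,G_1,G_2$ with vertex sets $\mathbb Z_q\setminus S$, $\mathbb Z_q\setminus T$, $\mathbb Z_q$, $\mathbb Z_q$ respectively, the amalgam $B^*_q(S,T,u_0,u_1)$ is obtained from $B_q(S,T,u_0,u_1)$ by adding the edges: $(0,u)_0(0,v)_0$ for $uv\in E(H_1)$; $(0,u)_1(0,v)_1$ for $uv\in E(H_2)$; $(x,u)_0(x,v)_0$ for $x\in\mathbb Z_q^*\setminus U_0$ and $uv\in E(G_1)$; $(m,u)_1(m,v)_1$ for $m\in\mathbb Z_q^*\setminus U_1$ and $uv\in E(G_2)$. Choice of parameters ($q\equiv 3 \bmod 4$; all elements and sums are taken modulo $q$): $S=\{\frac{q+1}{4},\frac{3q-1}{4}\}$, $T=\emptyset$, $u_0=0$, $u_1=1$ (so $U_0=\emptyset$, $U_1=\{\alpha^{q-2}\}$). $H_1$ has vertex set $\mathbb Z_q\setminus\{\frac{q+1}{4},\frac{3q-1}{4}\}$ and edges $\{j,j+\frac{q-1}{2}\}$ for $j\in\mathbb Z_q\setminus\{\frac{q+1}{4},\frac{3q-1}{4},\frac{3q+3}{4}\}$ together with $\{\frac{3q+3}{4},\frac{q-3}{4}\}$ (a $(q-2)$-cycle). $G_1$ has vertex set $\mathbb Z_q$ and edges $\{j,j+\frac{q-1}{2}\}$ for $j\in\mathbb Z_q$ (a $q$-cycle). $H_2$ and $G_2$ are both the graph with vertex set $\mathbb Z_q$ and edges $\{0,j\}$ for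 $j\in\mathbb Z_q^*\setminus\{\frac{q-1}{2},\frac{q+1}{2}\}$ together with $\{\frac{q+1}{4},\frac{q-1}{2}\}$ and $\{\frac{3q-1}{4},\frac{q+1}{2}\}$. *)

theory Defs
  imports
    "HOL-Library.Extended_Nat"
    "HOL-Number_Theory.Residue_Primitive_Roots"
begin

section \<open>Finite simple graphs, girth, and biregular cages\<close>

type_synonym 'a sgraph = "'a set \<times> 'a set set"

abbreviation verts :: "'a sgraph \<Rightarrow> 'a set" where
  "verts G \<equiv> fst G"

abbreviation edges :: "'a sgraph \<Rightarrow> 'a set set" where
  "edges G \<equiv> snd G"

definition simple_graph :: "'a sgraph \<Rightarrow> bool" where
  "simple_graph G \<longleftrightarrow>
     finite (verts G) \<and> (\<forall>e \<in> edges G. e \<subseteq> verts G \<and> card e = 2)"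

definition graph_order :: "'a sgraph \<Rightarrow> nat" where
  "graph_order G = card (verts G)"

definition graph_degree :: "'a sgraph \<Rightarrow> 'a \<Rightarrow> nat" where
  "graph_degree G v = card {e \<in> edges G. v \<in> e}"

text \<open>A cycle is given by the list of its vertices, the first vertex not being repeated
  at the end; its length is the length of the list.\<close>

definition is_cycle :: "'a sgraph \<Rightarrow> 'a list \<Rightarrow> bool" where
  "is_cycle G p \<longleftrightarrow>
     length p \<ge> 3 \<and> distinct p \<and> set p \<subseteq> verts G \<and>
     (\<forall>i < length p. {p ! i, p ! (Suc i mod length p)} \<in> edges G)"

text \<open>The girth of an acyclic graph is \<open>\<infinity>\<close>.\<close>

definition girth :: "'a sgraph \<Rightarrow> enat" where
  "girth G = Inf {enat (length p) | p. is_cycle G p}"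

definition biregular_graph :: "nat \<Rightarrow> nat \<Rightarrow> nat \<Rightarrow> 'a sgraph \<Rightarrow> bool" where
  "biregular_graph r m g G \<longleftrightarrow>
     2 \<le> r \<and> r < m \<and> simple_graph G \<and> girth G = enat g \<and>
     {graph_degree G v | v. v \<in> verts G} = {r, m}"

text \<open>Every finite graph is isomorphic to one whose vertices are natural numbers, so it
  suffices to compare with graphs on natural numbers; lemma \<open>biregular_cage_minimal\<close> below
  gives minimality among graphs over an arbitrary vertex type.\<close>

definition biregular_cage :: "nat \<Rightarrow> nat \<Rightarrow> nat \<Rightarrow> 'a sgraph \<Rightarrow> bool" where
  "biregular_cage r m g G \<longleftrightarrow>
     biregular_graph r m g G \<and>
     (\<forall>H :: nat sgraph. biregular_graph r m g H \<longrightarrow> graph_order G \<le> graph_order H)"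

definition map_graph :: "('a \<Rightarrow> 'b) \<Rightarrow> 'a sgraph \<Rightarrow> 'b sgraph" where
  "map_graph f G = (f ` verts G, (`) f ` edges G)"

lemma is_cycle_map_graph:
  assumes "is_cycle G p" and inj: "inj_on f (verts G)"
  shows "is_cycle (map_graph f G) (map f p)"
  unfolding is_cycle_def
proof (intro conjI allI impI)
  show "distinct (map f p)"
    using assms by (auto simp: is_cycle_def distinct_map intro: inj_on_subset)
  show "{map f p ! i, map f p ! (Suc i mod length (map f p))} \<in> edges (map_graph f G)"
    if "i < length (map f p)" for i
  proof -
    have i: "i < length p" and j: "Suc i mod length p < length p"
      using that by (auto intro!: mod_less_divisor)
    have "{p ! i, p ! (Suc i mod length p)} \<in> edges G"
      using assms i by (auto simp: is_cycle_def)
    then have "f ` {p ! i, p ! (Suc i mod length p)} \<in> edges (map_graph f G)"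
      unfolding map_graph_def snd_conv by (rule imageI)
    then show ?thesis using i j by simp
  qed
qed (use assms in \<open>auto simp: is_cycle_def map_graph_def\<close>)

lemma simple_graph_map_graph:
  assumes "simple_graph G" "inj_on f (verts G)"
  shows "simple_graph (map_graph f G)"
  using assms unfolding simple_graph_def map_graph_def
  by (auto simp: card_image inj_on_subset)

lemma map_graph_inv_into:
  assumes "simple_graph G" and inj: "inj_on f (verts G)"
  shows "map_graph (inv_into (verts G) f) (map_graph f G) = G"
proof -
  let ?h = "inv_into (verts G) f"
  have "?h ` f ` A = A" if "A \<subseteq> verts G" for A
    using inv_into_image_cancel[OF inj that] .
  moreover have "\<forall>e \<in> edges G. e \<subseteq> verts G"
    using assms by (auto simp: simple_graph_def)
  ultimately have "?h ` f ` verts G = verts G" "(`) ?h ` (`) f ` edges G = edges G"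
    by (auto simp: image_image)
  then show ?thesis by (simp add: map_graph_def)
qed

lemma girth_map_graph:
  assumes "simple_graph G" and inj: "inj_on f (verts G)"
  shows "girth (map_graph f G) = girth G"
proof -
  let ?h = "inv_into (verts G) f"
  have h: "inj_on ?h (verts (map_graph f G))"
    by (simp add: map_graph_def inj_on_inv_into)
  have "{enat (length p) | p. is_cycle (map_graph f G) p} = {enat (length p) | p. is_cycle G p}"
    using is_cycle_map_graph[OF _ inj] is_cycle_map_graph[OF _ h]
    unfolding map_graph_inv_into[OF assms]
    by (auto; metis length_map)
  then show ?thesis by (simp add: girth_def)
qed

lemma degree_map_graph:
  assumes "simple_graph G" and inj: "inj_on f (verts G)" and v: "v \<in> verts G"
  shows "graph_degree (map_graph f G) (f v) = graph_degree G v"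
proof -
  have sub: "e \<subseteq> verts G" if "e \<in> edges G" for e
    using that assms by (auto simp: simple_graph_def)
  have "{e \<in> edges (map_graph f G). f v \<in> e} = (`) f ` {e \<in> edges G. v \<in> e}"
    using sub inj_onD[OF inj _ v] by (fastforce simp: map_graph_def)
  moreover have "inj_on ((`) f) {e \<in> edges G. v \<in> e}"
    by (rule inj_onI) (use sub inj_on_image_eq_iff[OF inj] in auto)
  ultimately show ?thesis by (simp add: graph_degree_def card_image)
qed

lemma biregular_graph_map_graph:
  assumes "biregular_graph r m g G" and inj: "inj_on f (verts G)"
  shows "biregular_graph r m g (map_graph f G)"
proof -
  have G: "simple_graph G" using assms by (simp add: biregular_graph_def)
  have "{graph_degree (map_graph f G) v | v. v \<in> verts (map_graph f G)}
      = graph_degree (map_graph f G) ` f ` verts G"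
    by (auto simp: map_graph_def)
  also have "\<dots> = {graph_degree G v | v. v \<in> verts G}"
    using degree_map_graph[OF G inj] by (force simp: image_image)
  finally show ?thesis
    using assms G by (simp add: biregular_graph_def girth_map_graph simple_graph_map_graph)
qed

lemma biregular_cage_minimal:
  assumes "biregular_cage r m g G" and "biregular_graph r m g H"
  shows "graph_order G \<le> graph_order H"
proof -
  have "finite (verts H)"
    using assms by (simp add: biregular_graph_def simple_graph_def)
  then obtain f :: "'b \<Rightarrow> nat" where f: "inj_on f (verts H)"
    using finite_imp_inj_to_nat_seg by blast
  have "graph_order (map_graph f H) = graph_order H"
    by (simp add: graph_order_def map_graph_def card_image f)
  then show ?thesis
    using assms biregular_graph_map_graph[OF assms(2) f] by (metis biregular_cage_def)
qed


section \<open>The graphs \<open>B\<^sub>q\<close> and their amalgams\<close>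

text \<open>Residues modulo \<open>q\<close> are represented by the natural numbers below \<open>q\<close>.\<close>

abbreviation Zmod :: "nat \<Rightarrow> nat set" where
  "Zmod q \<equiv> {..<q}"

text \<open>\<open>V0 x y\<close> and \<open>V1 m b\<close> stand for $(x,y)_0$ and $(m,b)_1$.\<close>

datatype bvertex = V0 nat nat | V1 nat nat

definition B_verts :: "nat \<Rightarrow> bvertex set" where
  "B_verts q = {V0 x y | x y. x \<in> Zmod q \<and> y \<in> Zmod q} \<union>
               {V1 m b | m b. m \<in> Zmod q \<and> b \<in> Zmod q}"

definition B_graph :: "nat \<Rightarrow> bvertex sgraph" where
  "B_graph q =
     (B_verts q,
      {{V0 x y, V1 m b} | x y m b.
         x \<in> Zmod q \<and> y \<in> Zmod q \<and> m \<in> Zmod q \<and> b \<in> Zmod q \<and> y = (m * x + b) mod q})"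

definition P_block :: "nat \<Rightarrow> nat \<Rightarrow> bvertex set" where
  "P_block q x = {V0 x y | y. y \<in> Zmod q}"

definition L_block :: "nat \<Rightarrow> nat \<Rightarrow> bvertex set" where
  "L_block q m = {V1 m b | b. b \<in> Zmod q}"

definition delete_verts :: "'a sgraph \<Rightarrow> 'a set \<Rightarrow> 'a sgraph" where
  "delete_verts G W = (verts G - W, {e \<in> edges G. e \<inter> W = {}})"

definition U_set :: "nat \<Rightarrow> nat \<Rightarrow> nat \<Rightarrow> nat set" where
  "U_set q \<alpha> u = {\<alpha> ^ (q - j) mod q | j. j \<in> {2..u + 1}}"

definition B_deleted :: "nat \<Rightarrow> nat \<Rightarrow> nat set \<Rightarrow> nat set \<Rightarrow> nat \<Rightarrow> nat \<Rightarrow> bvertex sgraph" where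
  "B_deleted q \<alpha> S T u0 u1 =
     delete_verts (B_graph q)
       ({V0 0 y | y. y \<in> S} \<union> {V1 0 b | b. b \<in> T} \<union>
        (\<Union>x \<in> U_set q \<alpha> u0. P_block q x) \<union> (\<Union>m \<in> U_set q \<alpha> u1. L_block q m))"

definition B_amalgam ::
  "nat \<Rightarrow> nat \<Rightarrow> nat set \<Rightarrow> nat set \<Rightarrow> nat \<Rightarrow> nat \<Rightarrow>
   nat sgraph \<Rightarrow> nat sgraph \<Rightarrow> nat sgraph \<Rightarrow> nat sgraph \<Rightarrow> bvertex sgraph" where
  "B_amalgam q \<alpha> S T u0 u1 H1 H2 G1 G2 =
     (verts (B_deleted q \<alpha> S T u0 u1),
      edges (B_deleted q \<alpha> S T u0 u1) \<union>
      {{V0 0 u, V0 0 v} | u v. {u, v} \<in> edges H1} \<union>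
      {{V1 0 u, V1 0 v} | u v. {u, v} \<in> edges H2} \<union>
      {{V0 x u, V0 x v} | x u v. x \<in> Zmod q - {0} - U_set q \<alpha> u0 \<and> {u, v} \<in> edges G1} \<union>
      {{V1 m u, V1 m v} | m u v. m \<in> Zmod q - {0} - U_set q \<alpha> u1 \<and> {u, v} \<in> edges G2})"


section \<open>The parameters for \<open>q \<equiv> 3 (mod 4)\<close>\<close>

text \<open>All uses of \<open>div\<close> below are exact divisions when \<open>q \<equiv> 3 (mod 4)\<close>.\<close>

definition S_par :: "nat \<Rightarrow> nat set" where
  "S_par q = {(q + 1) div 4, (3 * q - 1) div 4}"

definition T_par :: "nat set" where
  "T_par = {}"

definition H1_par :: "nat \<Rightarrow> nat sgraph" where
  "H1_par q =
     (Zmod q - {(q + 1) div 4, (3 * q - 1) div 4},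
      {{j, (j + (q - 1) div 2) mod q} | j.
         j \<in> Zmod q - {(q + 1) div 4, (3 * q - 1) div 4, (3 * q + 3) div 4}} \<union>
      {{(3 * q + 3) div 4, (q - 3) div 4}})"

definition G1_par :: "nat \<Rightarrow> nat sgraph" where
  "G1_par q = (Zmod q, {{j, (j + (q - 1) div 2) mod q} | j. j \<in> Zmod q})"

definition star_par :: "nat \<Rightarrow> nat sgraph" where
  "star_par q =
     (Zmod q,
      {{0, j} | j. j \<in> Zmod q - {0} - {(q - 1) div 2, (q + 1) div 2}} \<union>
      {{(q + 1) div 4, (q - 1) div 2}, {(3 * q - 1) div 4, (q + 1) div 2}})"

definition H2_par :: "nat \<Rightarrow> nat sgraph" where
  "H2_par q = star_par q"

definition G2_par :: "nat \<Rightarrow> nat sgraph" where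
  "G2_par q = star_par q"

end

theory Submission
  imports Defs
begin

text \<open>Minimality is the Moore bound: when the girth is 5 and all degrees are at least \<open>r\<close>, the
  sets \<open>{u} \<union> N(u) - {v}\<close> for the neighbours \<open>u\<close> of a vertex \<open>v\<close> of degree \<open>m\<close> are disjoint
  with at least \<open>r\<close> elements each, so the order is at least \<open>r m + 1\<close>.
  In the amalgam, \<open>B\<^sub>q\<close> has no 4-cycle because two lines meet at most once, and the graphs added to
  the blocks have no 3- or 4-cycles. The only other threat is a 4-cycle made of one added edge on
  each side. Its two edges would have equal weight (difference of the ends) modulo \<open>q\<close>; but
  \<open>G\<^sub>1\<close> consists exactly of the edges of weight \<open>\<plusminus>(q - 1)/2\<close>, and \<open>H\<^sub>2 = G\<^sub>2\<close> has no such
  edge. The one edge of \<open>H\<^sub>1\<close> with another weight lies in the block \<open>x = 0\<close>, where incidence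
  preserves the second coordinate, and it is not an edge of \<open>H\<^sub>2\<close>.\<close>

section \<open>Girth five and the Moore bound\<close>

abbreviation nbrs :: "'a sgraph \<Rightarrow> 'a \<Rightarrow> 'a set" where
  "nbrs G v \<equiv> {w. {v, w} \<in> edges G}"

text \<open>Any coincidence among the three vertices turns one of the edges into a loop, so in a
  simple graph the condition speaks of genuine triangles.\<close>

definition triangle_free :: "'a sgraph \<Rightarrow> bool" where
  "triangle_free G \<longleftrightarrow> (\<forall>a b c. \<not> ({a, b} \<in> edges G \<and> {b, c} \<in> edges G \<and> {c, a} \<in> edges G))"

text \<open>Consecutive vertices of a closed walk in a simple graph differ anyway; only the two
  opposite pairs can coincide without giving a shorter cycle.\<close>

definition C4_free :: "'a sgraph \<Rightarrow> bool" where
  "C4_free G \<longleftrightarrow> (\<forall>a b c d. {a, b} \<in> edges G \<and> {b, c} \<in> edges G \<and>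
     {c, d} \<in> edges G \<and> {d, a} \<in> edges G \<longrightarrow> a = c \<or> b = d)"

lemma triangle_freeD:
  assumes "triangle_free G" "{a, b} \<in> edges G" "{b, c} \<in> edges G"
  shows "{c, a} \<notin> edges G"
  using assms unfolding triangle_free_def by blast

lemma C4_freeD:
  assumes "C4_free G" "{a, b} \<in> edges G" "{b, c} \<in> edges G" "{c, d} \<in> edges G" "{d, a} \<in> edges G"
  shows "a = c \<or> b = d"
  using assms unfolding C4_free_def by blast

lemma simple_graph_edgeD:
  assumes "simple_graph G" "{a, b} \<in> edges G"
  shows "a \<in> verts G" "b \<in> verts G" "a \<noteq> b"
  using assms by (auto simp: simple_graph_def dest!: bspec)

lemma graph_degree_eq_card_nbrs:
  assumes "simple_graph G"
  shows "graph_degree G v = card (nbrs G v)"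
proof -
  have "{e \<in> edges G. v \<in> e} = (\<lambda>w. {v, w}) ` nbrs G v"
  proof -
    have "\<exists>w. e = {v, w}" if "e \<in> edges G" "v \<in> e" for e
    proof -
      have "card e = 2" using assms that by (auto simp: simple_graph_def)
      then show ?thesis using that by (auto simp: card_2_iff)
    qed
    then show ?thesis by fastforce
  qed
  moreover have "inj_on (\<lambda>w. {v, w}) (nbrs G v)"
    by (auto intro!: inj_onI simp: doubleton_eq_iff)
  ultimately show ?thesis by (simp add: graph_degree_def card_image)
qed

lemma is_cycle_3I:
  assumes "simple_graph G" "{a, b} \<in> edges G" "{b, c} \<in> edges G" "{c, a} \<in> edges G"
  shows "is_cycle G [a, b, c]"
  using assms simple_graph_edgeD[OF assms(1)] simple_graph_edgeD(3)[OF assms(1), of c c]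
  by (auto simp: is_cycle_def less_Suc_eq)

lemma is_cycle_4I:
  assumes "simple_graph G" "{a, b} \<in> edges G" "{b, c} \<in> edges G" "{c, d} \<in> edges G"
    "{d, a} \<in> edges G" "a \<noteq> c" "b \<noteq> d"
  shows "is_cycle G [a, b, c, d]"
  using assms simple_graph_edgeD[OF assms(1)] simple_graph_edgeD(3)[OF assms(1), of d d]
  by (auto simp: is_cycle_def less_Suc_eq)

lemma girth_le: "is_cycle G p \<Longrightarrow> girth G \<le> enat (length p)"
  unfolding girth_def by (rule Inf_lower) auto

lemma girth_5_imp_free:
  assumes "simple_graph G" "girth G = 5"
  shows "triangle_free G" "C4_free G"
proof -
  show "triangle_free G"
    unfolding triangle_free_def using girth_le[OF is_cycle_3I[OF assms(1)]] assms(2)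
    by (auto simp: numeral_eq_enat)
  show "C4_free G"
    unfolding C4_free_def using girth_le[OF is_cycle_4I[OF assms(1)]] assms(2)
    by (auto simp: numeral_eq_enat)
qed

lemma girth_eq_5I:
  assumes "triangle_free G" "C4_free G" "is_cycle G p" "length p = 5"
  shows "girth G = 5"
proof (rule antisym)
  show "girth G \<le> 5"
    using girth_le[OF assms(3)] assms(4) by (simp add: numeral_eq_enat)
  show "5 \<le> girth G"
    unfolding girth_def
  proof (rule Inf_greatest, clarify)
    fix p :: "'a list" assume p: "is_cycle G p"
    have "length p \<noteq> 3"
    proof
      assume l: "length p = 3"
      then have *: "{p ! i, p ! (Suc i mod 3)} \<in> edges G" if "i < 3" for i
        using p that by (auto simp: is_cycle_def)
      have "{p ! 0, p ! 1} \<in> edges G" "{p ! 1, p ! 2} \<in> edges G" "{p ! 2, p ! 0} \<in> edges G"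
        using *[of 0] *[of 1] *[of 2] by (simp_all add: Suc_1[unfolded One_nat_def])
      then show False using triangle_freeD[OF assms(1)] by blast
    qed
    moreover have "length p \<noteq> 4"
    proof
      assume l: "length p = 4"
      then have *: "{p ! i, p ! (Suc i mod 4)} \<in> edges G" if "i < 4" for i
        using p that by (auto simp: is_cycle_def)
      have "{p ! 0, p ! 1} \<in> edges G" "{p ! 1, p ! 2} \<in> edges G"
        "{p ! 2, p ! 3} \<in> edges G" "{p ! 3, p ! 0} \<in> edges G"
        using *[of 0] *[of 1] *[of 2] *[of 3] by (simp_all add: Suc_1[unfolded One_nat_def])
      then have "p ! 0 = p ! 2 \<or> p ! 1 = p ! 3"
        by (rule C4_freeD[OF assms(2)])
      then show False using p l by (auto simp: is_cycle_def nth_eq_iff_index_eq)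
    qed
    moreover have "length p \<ge> 3" using p by (simp add: is_cycle_def)
    ultimately show "5 \<le> enat (length p)" by (simp add: numeral_eq_enat)
  qed
qed

lemma Moore_bound_girth_5:
  assumes G: "simple_graph G" and free: "triangle_free G" "C4_free G"
    and deg: "\<And>w. w \<in> verts G \<Longrightarrow> r \<le> graph_degree G w"
    and v: "v \<in> verts G"
  shows "r * graph_degree G v + 1 \<le> graph_order G"
proof -
  define C where "C = (\<lambda>u. insert u (nbrs G u - {v}))"
  note D = simple_graph_edgeD[OF G]
  have fin: "finite (verts G)" using G by (simp add: simple_graph_def)
  have finN: "finite (nbrs G u)" for u
    by (rule finite_subset[OF _ fin]) (auto dest: D)
  have cardC: "r \<le> card (C u)" if u: "u \<in> nbrs G v" for u
  proof -
    \<comment> \<open>Passing from \<open>nbrs G u\<close> to \<open>C u\<close> trades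
      \<open>v\<close> for \<open>u\<close>, so the size remains the degree of
      \<open>u\<close>.\<close>
    have "v \<in> nbrs G u" "u \<notin> nbrs G u"
      using u D(3) D(3)[of u u] by (auto simp: insert_commute)
    then have "card (C u) = card (nbrs G u)"
      unfolding C_def using finN[of u] card_Suc_Diff1[of "nbrs G u" v] by auto
    then show ?thesis using deg[of u] u D(2) graph_degree_eq_card_nbrs[OF G, of u] by auto
  qed
  have disj: "C u \<inter> C w = {}" if "u \<in> nbrs G v" "w \<in> nbrs G v" "u \<noteq> w" for u w
  proof -
    have uw: "{v, u} \<in> edges G" "{w, v} \<in> edges G" "{u, v} \<in> edges G" "{v, w} \<in> edges G"
      using that by (simp_all add: insert_commute)
    \<comment> \<open>A common element of \<open>C u\<close> and \<open>C w\<close> would come from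
      an edge between \<open>u\<close> and \<open>w\<close>, closing a triangle with
      \<open>v\<close>, or from a second common neighbour \<open>x\<close>, closing the 4-cycle
      \<open>v\<close>, \<open>u\<close>, \<open>x\<close>, \<open>w\<close>.\<close>
    have "{u, w} \<notin> edges G"
      using free(1) uw unfolding triangle_free_def by blast
    moreover have "x = v" if "{u, x} \<in> edges G" "{w, x} \<in> edges G" for x
      using free(2)[unfolded C4_free_def, rule_format, of v u x w] uw that \<open>u \<noteq> w\<close>
      by (auto simp: insert_commute)
    ultimately show ?thesis using \<open>u \<noteq> w\<close> unfolding C_def by (auto simp: insert_commute)
  qed
  have finC: "finite (C u)" for u unfolding C_def using finN by simp
  have "r * graph_degree G v = (\<Sum>u\<in>nbrs G v. r)"
    by (simp add: graph_degree_eq_card_nbrs[OF G])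
  also have "\<dots> \<le> (\<Sum>u\<in>nbrs G v. card (C u))"
    by (rule sum_mono) (rule cardC)
  also have "\<dots> = card (\<Union>u\<in>nbrs G v. C u)"
    by (rule card_UN_disjoint[symmetric]) (use finN finC disj in auto)
  also have "\<dots> \<le> card (verts G - {v})"
  proof (rule card_mono)
    have "v \<notin> nbrs G v" using D(3)[of v v] by auto
    then show "(\<Union>u\<in>nbrs G v. C u) \<subseteq> verts G - {v}"
      unfolding C_def using D by auto
  qed (use fin in simp)
  finally show ?thesis
    using v fin card_Suc_Diff1[of "verts G" v] unfolding graph_order_def by linarith
qed

lemma biregular_graph_5_order_ge:
  assumes "biregular_graph r m 5 G"
  shows "r * m + 1 \<le> graph_order G"
proof -
  have G: "simple_graph G" "girth G = 5" "r < m"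
    and deg: "{graph_degree G v | v. v \<in> verts G} = {r, m}"
    using assms by (auto simp: biregular_graph_def numeral_eq_enat)
  obtain v where v: "v \<in> verts G" "graph_degree G v = m"
  proof -
    have "m \<in> {graph_degree G v | v. v \<in> verts G}" unfolding deg by simp
    then show ?thesis using that by blast
  qed
  have "r \<le> graph_degree G w" if "w \<in> verts G" for w
  proof -
    have "graph_degree G w \<in> {r, m}" unfolding deg[symmetric] using that by blast
    then show ?thesis using \<open>r < m\<close> by auto
  qed
  from Moore_bound_girth_5[OF G(1) girth_5_imp_free[OF G(1,2)] this v(1)]
  show ?thesis using v(2) by simp
qed


section \<open>The graphs inside the blocks\<close>

text \<open>The half step 2n+1 either stays below q or wraps around once, and then lowers x by q -
  (2n+1) = 2n+2. This removes \<open>mod\<close> from all statements about the block graphs and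
  leaves linear arithmetic.\<close>

lemma shift_mod_iff:
  fixes x y n q :: nat
  assumes "q = 4 * n + 3" "x < q"
  shows "y = (x + (2 * n + 1)) mod q \<longleftrightarrow> y < q \<and> (y = x + (2 * n + 1) \<or> x = y + (2 * n + 2))"
  using assms by (cases "x + (2 * n + 1) < q") (auto simp: mod_if)

lemma G1_edge_iff:
  assumes "q = 4 * n + 3"
  shows "{u, v} \<in> edges (G1_par q) \<longleftrightarrow> u < q \<and> v < q \<and>
    (u = v + (2 * n + 1) \<or> u = v + (2 * n + 2) \<or> v = u + (2 * n + 1) \<or> v = u + (2 * n + 2))"
proof -
  have h: "(q - 1) div 2 = 2 * n + 1" using assms by simp
  have "{u, v} \<in> edges (G1_par q) \<longleftrightarrow>
      u < q \<and> v = (u + (2 * n + 1)) mod q \<or> v < q \<and> u = (v + (2 * n + 1)) mod q"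
    unfolding G1_par_def h by (auto simp: doubleton_eq_iff)
  then show ?thesis
    using shift_mod_iff[OF assms, of u v] shift_mod_iff[OF assms, of v u] by argo
qed

text \<open>The removed vertices n+1 and 3n+2 are consecutive on the cycle G_1, inside the path n,
  3n+2, n+1, 3n+3. The extra edge is the chord that bridges this gap.\<close>

lemma H1_edge_iff:
  assumes q: "q = 4 * n + 3" and n: "n \<ge> 1"
  shows "{u, v} \<in> edges (H1_par q) \<longleftrightarrow>
    {u, v} \<in> edges (G1_par q) \<and> {u, v} \<inter> {n + 1, 3 * n + 2} = {} \<or>
    {u, v} = {3 * n + 3, n}"
proof -
  have h: "(q - 1) div 2 = 2 * n + 1" "(q + 1) div 4 = n + 1" "(3 * q - 1) div 4 = 3 * n + 2"
    "(3 * q + 3) div 4 = 3 * n + 3" "(q - 3) div 4 = n" using q by simp_all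
  have 1: "{u, v} \<in> edges (H1_par q) \<longleftrightarrow>
      u < q \<and> u \<notin> {n + 1, 3 * n + 2, 3 * n + 3} \<and> v = (u + (2 * n + 1)) mod q \<or>
      v < q \<and> v \<notin> {n + 1, 3 * n + 2, 3 * n + 3} \<and> u = (v + (2 * n + 1)) mod q \<or>
      {u, v} = {3 * n + 3, n}"
    unfolding H1_par_def h by (auto simp: doubleton_eq_iff)
  \<comment> \<open>Exactly three shift edges meet the removed pair, namely those starting at n+1,
    3n+2 and 3n+3; these starting points are the ones omitted in \<open>H1_par\<close>.\<close>
  have 2: "x < q \<and> x \<notin> {n + 1, 3 * n + 2, 3 * n + 3} \<and> y = (x + (2 * n + 1)) mod q \<longleftrightarrow>
      (x < q \<and> y < q \<and> (y = x + (2 * n + 1) \<or> x = y + (2 * n + 2))) \<and>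
      {x, y} \<inter> {n + 1, 3 * n + 2} = {}" for x y
  proof -
    have "x \<notin> {n + 1, 3 * n + 2, 3 * n + 3} \<longleftrightarrow> {x, y} \<inter> {n + 1, 3 * n + 2} = {}"
      if "y = x + (2 * n + 1) \<or> x = y + (2 * n + 2)" "x < q" "y < q"
      using that
    proof (elim disjE)
      assume "y = x + (2 * n + 1)"
      then show ?thesis using \<open>y < q\<close> q n by auto
    next
      assume "x = y + (2 * n + 2)"
      then show ?thesis using \<open>x < q\<close> q n by auto
    qed
    then show ?thesis using shift_mod_iff[OF q, of x y] by argo
  qed
  show ?thesis
    unfolding 1 2 G1_edge_iff[OF q] insert_commute[of v u] by argo
qed

lemma star_edge_iff:
  assumes "q = 4 * n + 3"
  shows "{b, c} \<in> edges (star_par q) \<longleftrightarrow>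
    b = 0 \<and> c < q \<and> c \<notin> {0, 2 * n + 1, 2 * n + 2} \<or>
    c = 0 \<and> b < q \<and> b \<notin> {0, 2 * n + 1, 2 * n + 2} \<or>
    {b, c} = {n + 1, 2 * n + 1} \<or> {b, c} = {3 * n + 2, 2 * n + 2}"
proof -
  have h: "(q - 1) div 2 = 2 * n + 1" "(q + 1) div 2 = 2 * n + 2" "(q + 1) div 4 = n + 1"
    "(3 * q - 1) div 4 = 3 * n + 2" using assms by simp_all
  show ?thesis unfolding star_par_def h by (auto simp: doubleton_eq_iff)
qed

section \<open>Triangles and 4-cycles in G_1, H_1 and the star\<close>

lemma G1_triangle_free:
  assumes "q = 4 * n + 3" "n \<ge> 1"
  shows "triangle_free (G1_par q)"
  unfolding triangle_free_def G1_edge_iff[OF assms(1)] using assms by auto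

text \<open>The two neighbours of b in G_1 are consecutive residues, so a and c differ by 1 modulo
  q; the last case is the wrap-around pair 0 and q-1. In every case a and c determine b, and a
  unique common neighbour rules out 4-cycles.\<close>

lemma G1_common_nbr:
  assumes "q = 4 * n + 3" "{a, b} \<in> edges (G1_par q)" "{b, c} \<in> edges (G1_par q)" "a < c"
  shows "c = a + 1 \<and> (b = a + (2 * n + 2) \<and> a \<le> 2 * n \<or> a = b + (2 * n + 1)) \<or>
    c = a + (4 * n + 2) \<and> b = 2 * n + 1"
  using assms(2-4) unfolding G1_edge_iff[OF assms(1)] unfolding assms(1)
  by (elim conjE disjE) auto

lemma G1_C4_free:
  assumes "q = 4 * n + 3" "n \<ge> 1"
  shows "C4_free (G1_par q)"
  unfolding C4_free_def
proof (intro allI impI, elim conjE)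
  fix a b c d
  assume e: "{a, b} \<in> edges (G1_par q)" "{b, c} \<in> edges (G1_par q)"
    "{c, d} \<in> edges (G1_par q)" "{d, a} \<in> edges (G1_par q)"
  have *: "b = d" if "{a, b} \<in> edges (G1_par q)" "{b, c} \<in> edges (G1_par q)"
    "{c, d} \<in> edges (G1_par q)" "{d, a} \<in> edges (G1_par q)" "a < c" for a b c d
    using G1_common_nbr[OF assms(1) that(1,2,5)] G1_common_nbr[OF assms(1), of a d c]
      that(3,4,5) assms(2) by (auto simp: insert_commute)
  consider "a = c" | "a < c" | "c < a" by linarith
  then show "a = c \<or> b = d"
    using *[of a b c d] *[of c d a b] e by cases auto
qed

lemma H1_edge_imp_G1_edge:
  assumes "q = 4 * n + 3" "n \<ge> 1" "{u, v} \<in> edges (H1_par q)" "{u, v} \<noteq> {n, 3 * n + 3}"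
  shows "{u, v} \<in> edges (G1_par q)"
  using assms(3,4) unfolding H1_edge_iff[OF assms(1,2)] by (simp add: insert_commute)

text \<open>These are the surroundings of the chord: its ends have one further neighbour each, 3n+1
  and n+2. Those two differ by 2n-1, which is no weight of G_1.\<close>

lemma H1_nbr:
  assumes "q = 4 * n + 3" "n \<ge> 1"
  shows "{n, v} \<in> edges (H1_par q) \<Longrightarrow> v = 3 * n + 1 \<or> v = 3 * n + 3"
    and "{3 * n + 3, v} \<in> edges (H1_par q) \<Longrightarrow> v = n + 2 \<or> v = n"
    and "{3 * n + 1, n + 2} \<notin> edges (H1_par q)"
proof -
  show "v = 3 * n + 1 \<or> v = 3 * n + 3" if "{n, v} \<in> edges (H1_par q)"
    using that assms(2) unfolding H1_edge_iff[OF assms] G1_edge_iff[OF assms(1)] doubleton_eq_iff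
    unfolding assms(1) by (elim disjE conjE) auto
  show "v = n + 2 \<or> v = n" if "{3 * n + 3, v} \<in> edges (H1_par q)"
    using that assms(2) unfolding H1_edge_iff[OF assms] G1_edge_iff[OF assms(1)] doubleton_eq_iff
    unfolding assms(1) by (elim disjE conjE) auto
  show "{3 * n + 1, n + 2} \<notin> edges (H1_par q)"
    unfolding H1_edge_iff[OF assms] G1_edge_iff[OF assms(1)] doubleton_eq_iff
    using assms(2) by auto
qed

text \<open>The path \<open>d\<close>, \<open>a\<close>, \<open>b\<close>, \<open>c\<close> has the
  chord in the middle. A triangle through the chord would need \<open>c = d\<close>, a 4-cycle an
  edge between \<open>c\<close> and \<open>d\<close>.\<close>

lemma H1_chord_in_no_short_cycle:
  assumes "q = 4 * n + 3" "n \<ge> 1" "{a, b} = {n, 3 * n + 3}"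
    "{b, c} \<in> edges (H1_par q)" "{d, a} \<in> edges (H1_par q)" "c \<noteq> a" "d \<noteq> b"
  shows "c \<noteq> d" "{c, d} \<notin> edges (H1_par q)"
proof -
  have "a = n \<and> b = 3 * n + 3 \<or> a = 3 * n + 3 \<and> b = n"
    using assms(3) by (simp add: doubleton_eq_iff)
  then have "c = n + 2 \<and> d = 3 * n + 1 \<or> c = 3 * n + 1 \<and> d = n + 2"
    using assms(4-7) H1_nbr(1,2)[OF assms(1,2), of c] H1_nbr(1,2)[OF assms(1,2), of d]
    by (auto simp: insert_commute)
  then show "c \<noteq> d" "{c, d} \<notin> edges (H1_par q)"
    using H1_nbr(3)[OF assms(1,2)] assms(2) by (auto simp: insert_commute)
qed

lemma H1_not_loop:
  assumes "q = 4 * n + 3" "n \<ge> 1"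
  shows "{a} \<notin> edges (H1_par q)"
  using H1_edge_iff[OF assms, of a a] G1_edge_iff[OF assms(1), of a a]
  by (auto simp: doubleton_eq_iff)

lemma H1_triangle_free:
  assumes "q = 4 * n + 3" "n \<ge> 1"
  shows "triangle_free (H1_par q)"
  unfolding triangle_free_def
proof (intro allI notI, elim conjE)
  fix a b c
  assume e: "{a, b} \<in> edges (H1_par q)" "{b, c} \<in> edges (H1_par q)" "{c, a} \<in> edges (H1_par q)"
  have ne: "a \<noteq> b" "b \<noteq> c" "c \<noteq> a" using e H1_not_loop[OF assms] by auto
  \<comment> \<open>No edge of the triangle is the chord, so the whole triangle already lies in G_1.
    The 4-cycle case below is reduced in the same way.\<close>
  have *: "{x, y} \<in> edges (G1_par q)"
    if "{x, y} \<in> edges (H1_par q)" "{y, z} \<in> edges (H1_par q)" "{z, x} \<in> edges (H1_par q)"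
      "y \<noteq> z" "z \<noteq> x" for x y z
    using H1_edge_imp_G1_edge[OF assms that(1)]
      H1_chord_in_no_short_cycle(1)[OF assms _ that(2,3)] that(4,5) by blast
  show False
    using triangle_freeD[OF G1_triangle_free[OF assms]] *[OF e(1-3)] *[OF e(2,3,1)] *[OF e(3,1,2)] ne
    by metis
qed

lemma H1_C4_free:
  assumes "q = 4 * n + 3" "n \<ge> 1"
  shows "C4_free (H1_par q)"
  unfolding C4_free_def
proof (intro allI impI, elim conjE)
  fix a b c d
  assume e: "{a, b} \<in> edges (H1_par q)" "{b, c} \<in> edges (H1_par q)"
    "{c, d} \<in> edges (H1_par q)" "{d, a} \<in> edges (H1_par q)"
  show "a = c \<or> b = d"
  proof (rule ccontr)
    assume "\<not> (a = c \<or> b = d)"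
    then have ne: "a \<noteq> c" "b \<noteq> d" "c \<noteq> a" "d \<noteq> b" by auto
    have *: "{x, y} \<in> edges (G1_par q)"
      if "{x, y} \<in> edges (H1_par q)" "{y, z} \<in> edges (H1_par q)" "{z, w} \<in> edges (H1_par q)"
        "{w, x} \<in> edges (H1_par q)" "z \<noteq> x" "w \<noteq> y" for x y z w
      using H1_edge_imp_G1_edge[OF assms that(1)]
        H1_chord_in_no_short_cycle(2)[OF assms _ that(2,4)] that(3,5,6) by blast
    show False
      using C4_freeD[OF G1_C4_free[OF assms] *[OF e ne(3,4)] *[OF e(2,3,4,1) ne(4,1)]
        *[OF e(3,4,1,2) ne(1,2)] *[OF e(4,1,2,3) ne(2,3)]] ne by blast
  qed
qed

text \<open>The vertices 2n+1 and 2n+2 are leaves, so no cycle passes through them.\<close>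

lemma star_two_nbrs:
  assumes "q = 4 * n + 3" "n \<ge> 1" "{a, b} \<in> edges (star_par q)" "{a, d} \<in> edges (star_par q)" "b \<noteq> d"
  shows "a \<notin> {2 * n + 1, 2 * n + 2}"
  using assms(2-5) unfolding star_edge_iff[OF assms(1)] doubleton_eq_iff by auto

text \<open>Away from the two leaves only a star centred at 0 remains. Along a cycle, zero and
  nonzero vertices would therefore alternate: impossible for a triangle, and in a 4-cycle two
  opposite vertices would both be 0.\<close>

lemma star_edge_inner:
  assumes "q = 4 * n + 3" "{a, b} \<in> edges (star_par q)"
    "a \<notin> {2 * n + 1, 2 * n + 2}" "b \<notin> {2 * n + 1, 2 * n + 2}"
  shows "a = 0 \<longleftrightarrow> b \<noteq> 0"
  using assms(2-4) unfolding star_edge_iff[OF assms(1)] doubleton_eq_iff by auto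

lemma star_not_loop:
  assumes "q = 4 * n + 3" "n \<ge> 1"
  shows "{a} \<notin> edges (star_par q)"
  using star_edge_iff[OF assms(1), of a a] assms(2) by auto

lemma star_triangle_free:
  assumes "q = 4 * n + 3" "n \<ge> 1"
  shows "triangle_free (star_par q)"
  unfolding triangle_free_def
proof (intro allI notI, elim conjE)
  fix a b c
  assume e: "{a, b} \<in> edges (star_par q)" "{b, c} \<in> edges (star_par q)" "{c, a} \<in> edges (star_par q)"
  then have "a \<noteq> b" "b \<noteq> c" "c \<noteq> a" using star_not_loop[OF assms] by auto
  then have "v \<notin> {2 * n + 1, 2 * n + 2}" if "v \<in> {a, b, c}" for v
    using that e star_two_nbrs[OF assms, of a b c] star_two_nbrs[OF assms, of b c a]
      star_two_nbrs[OF assms, of c a b] by (auto simp: insert_commute)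
  then show False using e star_edge_inner[OF assms(1)] by (metis insertCI)
qed

lemma star_C4_free:
  assumes "q = 4 * n + 3" "n \<ge> 1"
  shows "C4_free (star_par q)"
  unfolding C4_free_def
proof (intro allI impI, elim conjE)
  fix a b c d
  assume e: "{a, b} \<in> edges (star_par q)" "{b, c} \<in> edges (star_par q)"
    "{c, d} \<in> edges (star_par q)" "{d, a} \<in> edges (star_par q)"
  show "a = c \<or> b = d"
  proof (rule ccontr)
    assume ne: "\<not> (a = c \<or> b = d)"
    have "v \<notin> {2 * n + 1, 2 * n + 2}" if "v \<in> {a, b, c, d}" for v
      using that e ne star_two_nbrs[OF assms, of a b d] star_two_nbrs[OF assms, of b c a]
        star_two_nbrs[OF assms, of c d b] star_two_nbrs[OF assms, of d a c]
      by (auto simp: insert_commute)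
    then have "a = 0 \<longleftrightarrow> b \<noteq> 0" "b = 0 \<longleftrightarrow> c \<noteq> 0" "c = 0 \<longleftrightarrow> d \<noteq> 0"
      using e star_edge_inner[OF assms(1)] by (metis insertCI)+
    then show False using ne by metis
  qed
qed

section \<open>Vertex ranges and degrees of the block graphs\<close>

lemma inner_edgeD:
  assumes "q = 4 * n + 3" "n \<ge> 1"
  shows "{u, v} \<in> edges (G1_par q) \<Longrightarrow> u < q \<and> v < q \<and> u \<noteq> v"
    and "{u, v} \<in> edges (H1_par q) \<Longrightarrow> u < q \<and> u \<notin> {n + 1, 3 * n + 2} \<and>
      v < q \<and> v \<notin> {n + 1, 3 * n + 2} \<and> u \<noteq> v"
    and "{u, v} \<in> edges (star_par q) \<Longrightarrow> u < q \<and> v < q \<and> u \<noteq> v"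
proof -
  show G1: "u < q \<and> v < q \<and> u \<noteq> v" if "{u, v} \<in> edges (G1_par q)"
    using that by (auto simp: G1_edge_iff[OF assms(1)])
  show "u < q \<and> u \<notin> {n + 1, 3 * n + 2} \<and> v < q \<and> v \<notin> {n + 1, 3 * n + 2} \<and> u \<noteq> v"
    if "{u, v} \<in> edges (H1_par q)"
    using that[unfolded H1_edge_iff[OF assms]]
  proof
    assume "{u, v} = {3 * n + 3, n}"
    then show ?thesis using assms unfolding doubleton_eq_iff by (elim disjE) simp_all
  qed (use G1 in blast)
  show "u < q \<and> v < q \<and> u \<noteq> v" if "{u, v} \<in> edges (star_par q)"
    using that assms unfolding star_edge_iff[OF assms(1)] doubleton_eq_iff
    by (elim disjE conjE) simp_all
qed

lemma G1_degree:
  assumes "q = 4 * n + 3" "n \<ge> 1" "y < q"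
  shows "card (nbrs (G1_par q) y) = 2"
proof -
  \<comment> \<open>Below the middle residue both neighbours lie above y, beyond it both lie below,
    and 2n+1 has one on each side.\<close>
  consider "y \<le> 2 * n" | "y = 2 * n + 1" | z where "y = z + (2 * n + 2)" "z \<le> 2 * n"
    using assms(1,3) that(3)[of "y - (2 * n + 2)"] that(1,2) by linarith
  then show ?thesis
  proof cases
    case 1
    then have "nbrs (G1_par q) y = {y + (2 * n + 1), y + (2 * n + 2)}"
      unfolding G1_edge_iff[OF assms(1)] using assms(1) by auto
    then show ?thesis by simp
  next
    case 2
    then have "nbrs (G1_par q) y = {0, 4 * n + 2}"
      unfolding G1_edge_iff[OF assms(1)] using assms(1) by auto
    then show ?thesis by simp
  next
    case 3
    then have "nbrs (G1_par q) y = {z, z + 1}"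
      unfolding G1_edge_iff[OF assms(1)] using assms(1) by auto
    then show ?thesis by simp
  qed
qed

lemma H1_degree:
  assumes "q = 4 * n + 3" "n \<ge> 1" "y < q" "y \<notin> {n + 1, 3 * n + 2}"
  shows "card (nbrs (H1_par q) y) = 2"
proof -
  consider "y = n" | "y = 3 * n + 3" | "y \<noteq> n" "y \<noteq> 3 * n + 3" by blast
  then show ?thesis
  proof cases
    case 1
    have "{n, 3 * n + 1} \<in> edges (H1_par q)" "{n, 3 * n + 3} \<in> edges (H1_par q)"
      unfolding H1_edge_iff[OF assms(1,2)] G1_edge_iff[OF assms(1)] using assms(1,2) by auto
    then have "nbrs (H1_par q) y = {3 * n + 1, 3 * n + 3}"
      using 1 H1_nbr(1)[OF assms(1,2)] by blast
    then show ?thesis by simp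
  next
    case 2
    have "{3 * n + 3, n + 2} \<in> edges (H1_par q)" "{3 * n + 3, n} \<in> edges (H1_par q)"
      unfolding H1_edge_iff[OF assms(1,2)] G1_edge_iff[OF assms(1)] using assms(1,2) by auto
    then have "nbrs (H1_par q) y = {n + 2, n}"
      using 2 H1_nbr(2)[OF assms(1,2)] by blast
    then show ?thesis by simp
  next
    case 3
    \<comment> \<open>The G_1 neighbours of the removed vertices are n, 3n+3 and the removed
      vertices themselves, so every other vertex keeps both of its neighbours.\<close>
    have "v \<notin> {n + 1, 3 * n + 2}" if "{y, v} \<in> edges (G1_par q)" for v
      using that 3 assms(3,4) unfolding G1_edge_iff[OF assms(1)] unfolding assms(1)
      by (elim conjE disjE) auto
    then have "nbrs (H1_par q) y = nbrs (G1_par q) y"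
      using 3 assms(4) unfolding H1_edge_iff[OF assms(1,2)] doubleton_eq_iff by blast
    then show ?thesis using G1_degree[OF assms(1-3)] by simp
  qed
qed

lemma star_degree_0:
  assumes "q = 4 * n + 3" "n \<ge> 1"
  shows "card (nbrs (star_par q) 0) = q - 3"
proof -
  have "nbrs (star_par q) 0 = {..<q} - {0, 2 * n + 1, 2 * n + 2}"
    unfolding star_edge_iff[OF assms(1)] doubleton_eq_iff using assms(2) by auto
  moreover have "{0, 2 * n + 1, 2 * n + 2} \<subseteq> {..<q}" using assms(1) by auto
  ultimately show ?thesis by (simp add: card_Diff_subset)
qed

text \<open>Degree 2 occurs exactly at the elements of \<open>S_par q\<close>. The additional edge
  there makes up for the deleted point that a line with this second coordinate loses in block
  0.\<close>

lemma star_degree_nonzero: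
  assumes "q = 4 * n + 3" "n \<ge> 1" "0 < b" "b < q"
  shows "card (nbrs (star_par q) b) = (if b \<in> {n + 1, 3 * n + 2} then 2 else 1)"
proof -
  consider "b = n + 1" | "b = 3 * n + 2" | "b = 2 * n + 1" | "b = 2 * n + 2"
    | "b \<notin> {n + 1, 3 * n + 2, 2 * n + 1, 2 * n + 2}" by blast
  then show ?thesis
  proof cases
    case 1
    then have "nbrs (star_par q) b = {0, 2 * n + 1}"
      unfolding star_edge_iff[OF assms(1)] doubleton_eq_iff using assms(1,2) by auto
    then show ?thesis using 1 by simp
  next
    case 2
    then have "nbrs (star_par q) b = {0, 2 * n + 2}"
      unfolding star_edge_iff[OF assms(1)] doubleton_eq_iff using assms(1,2) by auto
    then show ?thesis using 2 by simp
  next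
    case 3
    then have "nbrs (star_par q) b = {n + 1}"
      unfolding star_edge_iff[OF assms(1)] doubleton_eq_iff using assms(1,2) by auto
    then show ?thesis using 3 assms(2) by simp
  next
    case 4
    then have "nbrs (star_par q) b = {3 * n + 2}"
      unfolding star_edge_iff[OF assms(1)] doubleton_eq_iff using assms(1,2) by auto
    then show ?thesis using 4 assms(2) by simp
  next
    case 5
    then have "nbrs (star_par q) b = {0}"
      unfolding star_edge_iff[OF assms(1)] doubleton_eq_iff using assms(3,4) by auto
    then show ?thesis using 5 by simp
  qed
qed


section \<open>Incidences modulo \<open>q\<close>\<close>

lemma mod_eq_iff_less_double:
  fixes a q v :: nat
  assumes "a < 2 * q"
  shows "v = a mod q \<longleftrightarrow> v < q \<and> (v = a \<or> v + q = a)"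
  using assms by (auto simp: mod_if)

text \<open>Here \<open>q - a mod q\<close> stands for -a. With a = mx this gives the one line of
  slope m through a given point, hence the count of lines in \<open>degree_V0\<close>.\<close>

lemma eq_mod_add_iff:
  fixes a b y q :: nat
  assumes "y < q"
  shows "b < q \<and> y = (a + b) mod q \<longleftrightarrow> b = (y + (q - a mod q)) mod q"
proof -
  define t where "t = a mod q"
  have t: "t < q" using assms by (simp add: t_def)
  have "(a + b) mod q = (t + b) mod q" by (simp add: t_def mod_add_left_eq)
  moreover have "b < q \<and> y = (t + b) mod q \<longleftrightarrow> b = (y + (q - t)) mod q"
  proof (cases "b < q")
    case True
    obtain s where s: "q = t + s" "0 < s" using t less_imp_add_positive by blast
    have "b < q \<and> y = (t + b) mod q \<longleftrightarrow> y = t + b \<or> y + q = t + b"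
      using mod_eq_iff_less_double[of "t + b" q y] True t assms by auto
    also have "\<dots> \<longleftrightarrow> b + q = y + (q - t) \<or> b = y + (q - t)"
      using s by auto
    also have "\<dots> \<longleftrightarrow> b = (y + (q - t)) mod q"
      using mod_eq_iff_less_double[of "y + (q - t)" q b] True assms by auto
    finally show ?thesis .
  next
    case False
    then show ?thesis using assms by auto
  qed
  ultimately show ?thesis by (simp add: t_def)
qed

lemma mod_add_left_cancel:
  fixes a b c q :: nat
  assumes "(a + b) mod q = (a + c) mod q" "b < q" "c < q"
  shows "b = c"
  using assms by (metis cong_add_lcancel_nat cong_def mod_less)

text \<open>This is u - v = b - c modulo q without subtraction: u + c and v + b are congruent and
  both below 2q, so they differ by 0 or by q.\<close>

lemma mod_add_difference:
  fixes a b c q :: nat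
  assumes "u = (a + b) mod q" "v = (a + c) mod q" "b < q" "c < q"
  shows "u + c = v + b \<or> u + c = v + b + q \<or> u + c + q = v + b"
proof -
  define t where "t = a mod q"
  have "t < q" using assms(3) by (simp add: t_def)
  moreover have "u = (t + b) mod q" "v = (t + c) mod q"
    using assms(1,2) by (simp_all add: t_def mod_add_left_eq)
  ultimately show ?thesis using assms(3,4)
    by (cases "t + b < q"; cases "t + c < q") (auto simp: mod_if)
qed

lemma int_eq_if_dvd_diff:
  fixes a b q :: nat
  assumes "int q dvd int a - int b" "a < q" "b < q"
  shows "a = b"
  using assms by (metis mod_eq_dvd_iff mod_less of_nat_eq_iff zmod_int)

lemma two_lines_meet_once:
  fixes m x b q :: nat
  assumes "prime q" "(m * x + b) mod q = (m' * x + b') mod q"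
    "(m * x' + b) mod q = (m' * x' + b') mod q" "m < q" "m' < q" "x < q" "x' < q"
  shows "m = m' \<or> x = x'"
proof -
  have "int q dvd int (m * x + b) - int (m' * x + b')"
    "int q dvd int (m * x' + b) - int (m' * x' + b')"
    using assms(2,3) by (metis mod_eq_dvd_iff zmod_int)+
  \<comment> \<open>Subtracting the two incidences eliminates both intercepts and leaves a product
    of slope and abscissa differences, to which primality applies.\<close>
  then have "int q dvd (int (m * x + b) - int (m' * x + b')) - (int (m * x' + b) - int (m' * x' + b'))"
    by (rule dvd_diff)
  also have "\<dots> = (int m - int m') * (int x - int x')" by (simp add: algebra_simps)
  finally have "int q dvd int m - int m' \<or> int q dvd int x - int x'"
    using assms(1) by (simp add: prime_dvd_mult_iff)
  then show ?thesis using int_eq_if_dvd_diff assms(4-) by blast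
qed

section \<open>The amalgam\<close>

definition is_V0 :: "bvertex \<Rightarrow> bool" where
  "is_V0 v \<longleftrightarrow> (case v of V0 x y \<Rightarrow> True | V1 m b \<Rightarrow> False)"

text \<open>The construction lists block 0 apart from the other blocks; a single relation
  \<open>R\<close> lets one family of edges cover both.\<close>

lemma block_edges_merge:
  assumes "\<And>x u v. R x u v \<longleftrightarrow> x = 0 \<and> P u v \<or> x \<in> X \<and> Q u v"
  shows "{{f 0 u, f 0 v} | u v. P u v} \<union> {{f x u, f x v} | x u v. x \<in> X \<and> Q u v} =
    {{f x u, f x v} | x u v. R x u v}"
  unfolding assms by blast

text \<open>The deleted line block is recorded by its slope \<open>\<mu>\<close>. Since
  \<open>\<mu>\<close> is nonzero, block 0 of the lines survives and carries H_2.\<close>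

locale amalgam =
  fixes n q \<alpha> \<mu> :: nat and B :: "bvertex sgraph"
  assumes q: "q = 4 * n + 3" and prime: "prime q" and n: "n \<ge> 1"
    and \<mu>: "U_set q \<alpha> 1 = {\<mu>}" "0 < \<mu>" "\<mu> < q"
    and B: "B = B_amalgam q \<alpha> (S_par q) T_par 0 1 (H1_par q) (H2_par q) (G1_par q) (G2_par q)"
begin

section \<open>Vertices and edges of the amalgam\<close>

definition point_graph :: "nat \<Rightarrow> nat sgraph" where
  "point_graph x = (if x = 0 then H1_par q else G1_par q)"

lemma q_pos: "0 < q" "1 < q"
  using q by auto

lemma verts_B:
  "verts B = {V0 x y | x y. x < q \<and> y < q \<and> \<not> (x = 0 \<and> y \<in> {n + 1, 3 * n + 2})} \<union>
             {V1 m b | m b. m < q \<and> b < q \<and> m \<noteq> \<mu>}"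
proof -
  have h: "(q + 1) div 4 = n + 1" "(3 * q - 1) div 4 = 3 * n + 2" using q by simp_all
  have U0: "U_set q \<alpha> 0 = {}" by (simp add: U_set_def)
  show ?thesis
    unfolding B B_amalgam_def B_deleted_def delete_verts_def B_graph_def B_verts_def
      S_par_def T_par_def h \<mu>(1) U0 P_block_def L_block_def
    by auto
qed

lemma V0_in_verts: "V0 x y \<in> verts B \<longleftrightarrow> x < q \<and> y < q \<and> \<not> (x = 0 \<and> y \<in> {n + 1, 3 * n + 2})"
  by (simp add: verts_B)

lemma V1_in_verts: "V1 m b \<in> verts B \<longleftrightarrow> m < q \<and> b < q \<and> m \<noteq> \<mu>"
  by (simp add: verts_B)

text \<open>An incidence survives exactly when both of its ends do, so deletion is expressed by
  membership in \<open>verts B\<close>. The adjacency criteria by type of vertex follow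
  directly.\<close>

lemma edges_B:
  "edges B =
    {{V0 x ((m * x + b) mod q), V1 m b} | x m b.
       V0 x ((m * x + b) mod q) \<in> verts B \<and> V1 m b \<in> verts B} \<union>
    {{V0 x u, V0 x v} | x u v. x < q \<and> {u, v} \<in> edges (point_graph x)} \<union>
    {{V1 m u, V1 m v} | m u v. m < q \<and> m \<noteq> \<mu> \<and> {u, v} \<in> edges (star_par q)}"
proof -
  have h: "(q + 1) div 4 = n + 1" "(3 * q - 1) div 4 = 3 * n + 2" using q by simp_all
  have U0: "U_set q \<alpha> 0 = {}" by (simp add: U_set_def)
  \<comment> \<open>\<open>W\<close> is the set of deleted vertices: two points of block 0 and the
    line block of slope \<open>\<mu>\<close>.\<close>
  define W where "W = {V0 0 y | y. y \<in> S_par q} \<union> L_block q \<mu>"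
  have W: "{V0 x y, V1 m b} \<inter> W = {} \<longleftrightarrow> \<not> (x = 0 \<and> y \<in> {n + 1, 3 * n + 2}) \<and> m \<noteq> \<mu>" if "b < q" for x y m b
    using that unfolding W_def S_par_def L_block_def h by auto
  have "edges (B_deleted q \<alpha> (S_par q) T_par 0 1) = {e \<in> edges (B_graph q). e \<inter> W = {}}"
    unfolding B_deleted_def delete_verts_def T_par_def \<mu>(1) U0 W_def by simp
  also have "\<dots> = {{V0 x y, V1 m b} | x y m b. x < q \<and> y < q \<and> m < q \<and> b < q \<and>
      y = (m * x + b) mod q \<and> \<not> (x = 0 \<and> y \<in> {n + 1, 3 * n + 2}) \<and> m \<noteq> \<mu>}"
    (is "?L = ?R")
  proof
    show "?L \<subseteq> ?R"
    proof
      fix e assume "e \<in> ?L"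
      then obtain x y m b where "e = {V0 x y, V1 m b}" "x < q" "y < q" "m < q" "b < q"
        "y = (m * x + b) mod q" "e \<inter> W = {}" unfolding B_graph_def by auto
      then show "e \<in> ?R" using W[of b x y m] by blast
    qed
    show "?R \<subseteq> ?L"
    proof
      fix e assume "e \<in> ?R"
      then obtain x y m b where *: "e = {V0 x y, V1 m b}" "x < q" "y < q" "m < q" "b < q"
        "y = (m * x + b) mod q" "\<not> (x = 0 \<and> y \<in> {n + 1, 3 * n + 2}) \<and> m \<noteq> \<mu>" by blast
      then have "e \<inter> W = {}" using W[of b x y m] by blast
      with * show "e \<in> ?L" unfolding B_graph_def by auto
    qed
  qed
  also have "\<dots> = {{V0 x ((m * x + b) mod q), V1 m b} | x m b.
       V0 x ((m * x + b) mod q) \<in> verts B \<and> V1 m b \<in> verts B}"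
    unfolding V0_in_verts V1_in_verts by blast
  finally have del: "edges (B_deleted q \<alpha> (S_par q) T_par 0 1) =
    {{V0 x ((m * x + b) mod q), V1 m b} | x m b.
       V0 x ((m * x + b) mod q) \<in> verts B \<and> V1 m b \<in> verts B}" .
  have V0s: "{{V0 0 u, V0 0 v} | u v. {u, v} \<in> edges (H1_par q)} \<union>
      {{V0 x u, V0 x v} | x u v. x \<in> Zmod q - {0} - {} \<and> {u, v} \<in> edges (G1_par q)} =
      {{V0 x u, V0 x v} | x u v. x < q \<and> {u, v} \<in> edges (point_graph x)}"
    by (rule block_edges_merge) (use q_pos(1) in \<open>auto simp: point_graph_def\<close>)
  have V1s: "{{V1 0 u, V1 0 v} | u v. {u, v} \<in> edges (star_par q)} \<union>
      {{V1 m u, V1 m v} | m u v. m \<in> Zmod q - {0} - {\<mu>} \<and> {u, v} \<in> edges (star_par q)} =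
      {{V1 m u, V1 m v} | m u v. m < q \<and> m \<noteq> \<mu> \<and> {u, v} \<in> edges (star_par q)}"
    by (rule block_edges_merge) (use q_pos(1) \<mu>(2) in auto)
  have "edges B = edges (B_deleted q \<alpha> (S_par q) T_par 0 1) \<union>
      {{V0 0 u, V0 0 v} | u v. {u, v} \<in> edges (H1_par q)} \<union>
      {{V1 0 u, V1 0 v} | u v. {u, v} \<in> edges (star_par q)} \<union>
      {{V0 x u, V0 x v} | x u v. x \<in> Zmod q - {0} - {} \<and> {u, v} \<in> edges (G1_par q)} \<union>
      {{V1 m u, V1 m v} | m u v. m \<in> Zmod q - {0} - {\<mu>} \<and> {u, v} \<in> edges (star_par q)}"
    unfolding B B_amalgam_def snd_conv U0 \<mu>(1) H2_par_def G2_par_def by (rule refl)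
  then show ?thesis
    unfolding del V0s[symmetric] V1s[symmetric] by (simp only: Un_ac)
qed

lemma edge_V0_V0: "{V0 x u, V0 x' v} \<in> edges B \<longleftrightarrow> x = x' \<and> x < q \<and> {u, v} \<in> edges (point_graph x)"
  unfolding edges_B by (auto simp: doubleton_eq_iff insert_commute)

lemma edge_V1_V1:
  "{V1 m b, V1 m' c} \<in> edges B \<longleftrightarrow> m = m' \<and> m < q \<and> m \<noteq> \<mu> \<and> {b, c} \<in> edges (star_par q)"
  unfolding edges_B by (auto simp: doubleton_eq_iff insert_commute)

lemma edge_V0_V1:
  "{V0 x y, V1 m b} \<in> edges B \<longleftrightarrow> V0 x y \<in> verts B \<and> V1 m b \<in> verts B \<and> y = (m * x + b) mod q"
  unfolding edges_B by (auto simp: doubleton_eq_iff)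

lemma edge_V1_V0:
  "{V1 m b, V0 x y} \<in> edges B \<longleftrightarrow> V0 x y \<in> verts B \<and> V1 m b \<in> verts B \<and> y = (m * x + b) mod q"
  using edge_V0_V1 by (simp add: insert_commute)

lemma point_graph_edgeD:
  assumes "{u, v} \<in> edges (point_graph x)" "x < q"
  shows "V0 x u \<in> verts B" "V0 x v \<in> verts B" "u \<noteq> v"
  using assms inner_edgeD(1,2)[OF q n, of u v]
  unfolding V0_in_verts point_graph_def by (auto split: if_splits)

lemma point_graph_free: "triangle_free (point_graph x)" "C4_free (point_graph x)"
  using G1_triangle_free[OF q n] G1_C4_free[OF q n] H1_triangle_free[OF q n] H1_C4_free[OF q n]
  by (auto simp: point_graph_def)

lemma simple_B: "simple_graph B"
proof -
  have "finite (verts B)"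
  proof (rule finite_subset)
    show "verts B \<subseteq> (\<lambda>(x, y). V0 x y) ` ({..<q} \<times> {..<q}) \<union> (\<lambda>(m, b). V1 m b) ` ({..<q} \<times> {..<q})"
      unfolding verts_B by auto
  qed simp
  moreover have "e \<subseteq> verts B \<and> card e = 2" if "e \<in> edges B" for e
    using that unfolding edges_B
  proof (elim UnE)
    assume "e \<in> {{V0 x u, V0 x v} | x u v. x < q \<and> {u, v} \<in> edges (point_graph x)}"
    then obtain x u v where "e = {V0 x u, V0 x v}" "x < q" "{u, v} \<in> edges (point_graph x)" by blast
    then show ?thesis using point_graph_edgeD by simp
  next
    assume "e \<in> {{V1 m u, V1 m v} | m u v. m < q \<and> m \<noteq> \<mu> \<and> {u, v} \<in> edges (star_par q)}"
    then obtain m u v where "e = {V1 m u, V1 m v}" "m < q" "m \<noteq> \<mu>" "{u, v} \<in> edges (star_par q)"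
      by blast
    then show ?thesis using inner_edgeD(3)[OF q n, of u v] by (simp add: V1_in_verts)
  qed auto
  ultimately show ?thesis by (simp add: simple_graph_def)
qed

section \<open>Order and degrees of the amalgam\<close>

lemma order_B: "graph_order B = 2 * q * q - q - 2"
proof -
  let ?f = "\<lambda>(x, y). V0 x y" and ?g = "\<lambda>(m, b). V1 m b"
  let ?P = "{..<q} \<times> {..<q} - {(0, n + 1), (0, 3 * n + 2)}" and ?L = "({..<q} - {\<mu>}) \<times> {..<q}"
  have "verts B = ?f ` ?P \<union> ?g ` ?L"
    unfolding verts_B by (auto simp: image_iff)
  moreover have "?f ` ?P \<inter> ?g ` ?L = {}" by auto
  moreover have "inj_on ?f ?P" "inj_on ?g ?L" by (auto intro!: inj_onI)
  ultimately have "graph_order B = card ?P + card ?L"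
    unfolding graph_order_def by (simp add: card_Un_disjoint card_image del: card_cartesian_product)
  moreover have "card ?P = q * q - 2"
    using q by (subst card_Diff_subset) auto
  moreover have "card ?L = (q - 1) * q"
    using \<mu> by (simp add: card_Diff_subset)
  \<comment> \<open>This bound keeps the truncated subtractions exact when the two counts are
    added.\<close>
  moreover have "3 * q \<le> q * q" using q by (intro mult_right_mono) simp_all
  ultimately show ?thesis by (simp add: diff_mult_distrib mult.assoc; linarith)
qed

text \<open>Two neighbours lie in the block of the point, and each of the q-1 slopes other than
  \<open>\<mu>\<close> contributes one line.\<close>

lemma degree_V0:
  assumes "V0 x y \<in> verts B"
  shows "graph_degree B (V0 x y) = q + 1"
proof -
  have xy: "x < q" "y < q" "\<not> (x = 0 \<and> y \<in> {n + 1, 3 * n + 2})"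
    using assms by (auto simp: V0_in_verts)
  define f where "f = (\<lambda>m. (y + (q - (m * x) mod q)) mod q)"
  have f: "b < q \<and> y = (m * x + b) mod q \<longleftrightarrow> b = f m" for m b
    unfolding f_def by (rule eq_mod_add_iff[OF xy(2)])
  have "nbrs B (V0 x y) = V0 x ` nbrs (point_graph x) y \<union> (\<lambda>m. V1 m (f m)) ` ({..<q} - {\<mu>})" (is "_ = ?A \<union> ?C")
  proof (rule Set.set_eqI)
    show "w \<in> nbrs B (V0 x y) \<longleftrightarrow> w \<in> ?A \<union> ?C" for w
    proof (cases w)
      case (V0 x' y')
      then show ?thesis using xy by (auto simp: edge_V0_V0)
    next
      case (V1 m b)
      then show ?thesis using assms f[of b m] by (auto simp: edge_V0_V1 V1_in_verts)
    qed
  qed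
  moreover have "card (nbrs (point_graph x) y) = 2"
    using G1_degree[OF q n xy(2)] H1_degree[OF q n xy(2)] xy(3) by (auto simp: point_graph_def)
  moreover from this have "finite (nbrs (point_graph x) y)"
    by (simp add: card_ge_0_finite)
  moreover have "?A \<inter> ?C = {}" by auto
  ultimately have "card (nbrs B (V0 x y)) = 2 + card ({..<q} - {\<mu>})"
    by (simp add: card_Un_disjoint card_image inj_on_def)
  then show ?thesis
    using \<mu> q_pos by (simp add: graph_degree_eq_card_nbrs[OF simple_B])
qed

lemma degree_V1:
  assumes "V1 m b \<in> verts B"
  shows "graph_degree B (V1 m b) = (if b = 0 then 2 * q - 3 else q + 1)"
proof -
  have mb: "m < q" "b < q" "m \<noteq> \<mu>" using assms by (auto simp: V1_in_verts)
  \<comment> \<open>A line meets each point block once. In block 0 the incident point is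
    \<open>V0 0 b\<close>, which is missing precisely when b lies in \<open>S_par q\<close>.\<close>
  let ?X = "{x. x < q \<and> \<not> (x = 0 \<and> b \<in> {n + 1, 3 * n + 2})}"
  have "nbrs B (V1 m b) = V1 m ` nbrs (star_par q) b \<union> (\<lambda>x. V0 x ((m * x + b) mod q)) ` ?X"
    (is "_ = ?A \<union> ?C")
  proof (rule Set.set_eqI)
    show "w \<in> nbrs B (V1 m b) \<longleftrightarrow> w \<in> ?A \<union> ?C" for w
    proof (cases w)
      case (V1 x' y')
      then show ?thesis using mb by (auto simp: edge_V1_V1)
    next
      case (V0 x y)
      then show ?thesis using assms mb q_pos by (auto simp: edge_V1_V0 V0_in_verts)
    qed
  qed
  moreover have "finite (nbrs (star_par q) b)"
    by (rule finite_subset[of _ "{..<q}"]) (use inner_edgeD(3)[OF q n] in auto)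
  moreover have "?A \<inter> ?C = {}" by auto
  ultimately have "card (nbrs B (V1 m b)) = card (nbrs (star_par q) b) + card ?X"
    by (simp add: card_Un_disjoint card_image inj_on_def)
  moreover have "card ?X = (if b \<in> {n + 1, 3 * n + 2} then q - 1 else q)"
  proof -
    have "?X = (if b \<in> {n + 1, 3 * n + 2} then {..<q} - {0} else {..<q})" by auto
    then show ?thesis using q_pos by simp
  qed
  moreover have "card (nbrs (star_par q) b) =
      (if b = 0 then q - 3 else if b \<in> {n + 1, 3 * n + 2} then 2 else 1)"
    using star_degree_0[OF q n] star_degree_nonzero[OF q n _ mb(2)] by auto
  ultimately show ?thesis
    using q by (auto simp: graph_degree_eq_card_nbrs[OF simple_B])
qed

section \<open>Triangles and 4-cycles in the amalgam\<close>

lemma V0_common_nbr: "{V0 x u, V1 m b} \<in> edges B \<Longrightarrow> {V0 x v, V1 m b} \<in> edges B \<Longrightarrow> u = v"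
  by (simp add: edge_V0_V1)

text \<open>Distinct lines of equal slope share no point, dually to \<open>V0_common_nbr\<close>. As
  added edges stay inside a block, these two facts exclude mixed triangles and 4-cycles with exactly
  three vertices on one side.\<close>

lemma V1_common_nbr:
  assumes "{V0 x u, V1 m b} \<in> edges B" "{V0 x u, V1 m c} \<in> edges B"
  shows "b = c"
  using assms mod_add_left_cancel[of "m * x" b q c] by (simp add: edge_V0_V1 V1_in_verts)

lemma no_four_cycle_V0_V0_V1_V1:
  assumes "{V0 x u, V0 x' v} \<in> edges B" "{V0 x' v, V1 m' c} \<in> edges B"
    "{V1 m' c, V1 m b} \<in> edges B" "{V1 m b, V0 x u} \<in> edges B"
  shows False
proof -
  have uv: "x' = x" "{u, v} \<in> edges (point_graph x)" and bc: "m' = m" "{c, b} \<in> edges (star_par q)"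
    using assms(1,3) by (auto simp: edge_V0_V0 edge_V1_V1)
  have *: "u = (m * x + b) mod q" "v = (m * x + c) mod q" "b < q" "c < q"
    using assms(2,4) uv(1) bc(1) by (auto simp: edge_V0_V1 edge_V1_V0 V1_in_verts)
  show False
  \<comment> \<open>The chord of H_1 needs separate treatment because its weight is not that of
    G_1.\<close>
  proof (cases "x = 0 \<and> {u, v} = {3 * n + 3, n}")
    case True
    then have "u = b" "v = c" using * by simp_all
    then have "{c, b} = {3 * n + 3, n}" using True by (simp add: insert_commute)
    then show False
      using bc(2) q n unfolding star_edge_iff[OF q] doubleton_eq_iff by (elim disjE conjE) simp_all
  next
    case False
    then have "{u, v} \<in> edges (G1_par q)"
      using uv(2) H1_edge_iff[OF q n, of u v] by (auto simp: point_graph_def split: if_splits)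
    moreover have "u + c = v + b \<or> u + c = v + b + q \<or> u + c + q = v + b"
      by (rule mod_add_difference[OF *])
    \<comment> \<open>The weight passes from the point edge to the line edge: b and c differ by 2n+1
      or 2n+2, while star edges at 0 omit these values and the two others have difference n.\<close>
    ultimately have "b = c + (2 * n + 1) \<or> b = c + (2 * n + 2) \<or> c = b + (2 * n + 1) \<or> c = b + (2 * n + 2)"
      using *(3,4) unfolding G1_edge_iff[OF q] unfolding q by (elim conjE disjE) linarith+
    then show False
      using bc(2) q n unfolding star_edge_iff[OF q] doubleton_eq_iff by (elim disjE conjE) simp_all
  qed
qed

lemma four_cycle_V0_V1_V0_V1:
  assumes "{V0 x u, V1 m b} \<in> edges B" "{V1 m b, V0 x' v} \<in> edges B"
    "{V0 x' v, V1 m' c} \<in> edges B" "{V1 m' c, V0 x u} \<in> edges B"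
  shows "V0 x u = V0 x' v \<or> V1 m b = V1 m' c"
proof -
  have "(m * x + b) mod q = (m' * x + c) mod q" "(m * x' + b) mod q = (m' * x' + c) mod q"
    "m < q" "m' < q" "x < q" "x' < q"
    using assms by (simp_all add: edge_V0_V1 edge_V1_V0 V0_in_verts V1_in_verts)
  from two_lines_meet_once[OF prime this] show ?thesis
    using assms V0_common_nbr[of x u m b v] V1_common_nbr[of x u m b c]
    by (auto simp: insert_commute)
qed

lemma no_triangle_V0_V0_V1:
  assumes "is_V0 a" "is_V0 b" "\<not> is_V0 c" "{a, b} \<in> edges B" "{b, c} \<in> edges B" "{c, a} \<in> edges B"
  shows False
proof -
  obtain x u x' v m w where abc: "a = V0 x u" "b = V0 x' v" "c = V1 m w"
    using assms(1-3) by (auto simp: is_V0_def split: bvertex.splits)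
  then have "x' = x" using assms(4) by (simp add: edge_V0_V0)
  then have "a = b"
    using assms(5,6) abc V0_common_nbr[of x u m w v] by (simp add: insert_commute)
  then show False using simple_graph_edgeD(3)[OF simple_B assms(4)] by simp
qed

lemma no_triangle_V1_V1_V0:
  assumes "\<not> is_V0 a" "\<not> is_V0 b" "is_V0 c" "{a, b} \<in> edges B" "{b, c} \<in> edges B" "{c, a} \<in> edges B"
  shows False
proof -
  obtain m u m' v x w where abc: "a = V1 m u" "b = V1 m' v" "c = V0 x w"
    using assms(1-3) by (auto simp: is_V0_def split: bvertex.splits)
  then have "m' = m" using assms(4) by (simp add: edge_V1_V1)
  then have "a = b"
    using assms(5,6) abc V1_common_nbr[of x w m u v] by (simp add: insert_commute)
  then show False using simple_graph_edgeD(3)[OF simple_B assms(4)] by simp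
qed

lemma triangle_free_B: "triangle_free B"
  unfolding triangle_free_def
proof (intro allI notI, elim conjE)
  fix a b c assume e: "{a, b} \<in> edges B" "{b, c} \<in> edges B" "{c, a} \<in> edges B"
  consider "is_V0 a" "is_V0 b" "is_V0 c" | "\<not> is_V0 a" "\<not> is_V0 b" "\<not> is_V0 c"
    using no_triangle_V0_V0_V1[OF _ _ _ e] no_triangle_V0_V0_V1[OF _ _ _ e(2,3,1)]
      no_triangle_V0_V0_V1[OF _ _ _ e(3,1,2)] no_triangle_V1_V1_V0[OF _ _ _ e]
      no_triangle_V1_V1_V0[OF _ _ _ e(2,3,1)] no_triangle_V1_V1_V0[OF _ _ _ e(3,1,2)]
    by argo
  then show False
  proof cases
    case 1
    then obtain x u x' v x'' w where "a = V0 x u" "b = V0 x' v" "c = V0 x'' w"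
      by (auto simp: is_V0_def split: bvertex.splits)
    then show False
      using e triangle_freeD[OF point_graph_free(1)[of x], of u v w] by (auto simp: edge_V0_V0)
  next
    case 2
    then obtain x u x' v x'' w where "a = V1 x u" "b = V1 x' v" "c = V1 x'' w"
      by (auto simp: is_V0_def split: bvertex.splits)
    then show False
      using e triangle_freeD[OF star_triangle_free[OF q n], of u v w] by (simp add: edge_V1_V1)
  qed
qed

text \<open>The added edges from \<open>a\<close> put \<open>b\<close> and \<open>d\<close> into one
  block, where the line \<open>c\<close> meets only one point.\<close>

lemma four_cycle_three_V0:
  assumes "is_V0 a" "is_V0 b" "\<not> is_V0 c" "is_V0 d"
    "{a, b} \<in> edges B" "{b, c} \<in> edges B" "{c, d} \<in> edges B" "{d, a} \<in> edges B"
  shows "b = d"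
proof -
  obtain x0 w x u m z x' v where "a = V0 x0 w" "b = V0 x u" "c = V1 m z" "d = V0 x' v"
    using assms(1-4) by (auto simp: is_V0_def split: bvertex.splits)
  then show ?thesis
    using assms(5-8) V0_common_nbr[of x u m z v] by (auto simp: edge_V0_V0 insert_commute)
qed

lemma four_cycle_three_V1:
  assumes "\<not> is_V0 a" "\<not> is_V0 b" "is_V0 c" "\<not> is_V0 d"
    "{a, b} \<in> edges B" "{b, c} \<in> edges B" "{c, d} \<in> edges B" "{d, a} \<in> edges B"
  shows "b = d"
proof -
  obtain m0 w m u x z m' v where "a = V1 m0 w" "b = V1 m u" "c = V0 x z" "d = V1 m' v"
    using assms(1-4) by (auto simp: is_V0_def split: bvertex.splits)
  then show ?thesis
    using assms(5-8) V1_common_nbr[of x z m u v] by (auto simp: edge_V1_V1 insert_commute)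
qed

text \<open>When both opposite pairs are split between the sides, the two points are consecutive and
  so are the two lines: the cycle has one added edge on each side.\<close>

lemma four_cycle_two_V0:
  assumes "is_V0 a" "\<not> is_V0 c" "is_V0 b \<noteq> is_V0 d"
    "{a, b} \<in> edges B" "{b, c} \<in> edges B" "{c, d} \<in> edges B" "{d, a} \<in> edges B"
  shows False
proof (cases "is_V0 b")
  case True
  then obtain x u x' v m w m' z where "a = V0 x u" "b = V0 x' v" "c = V1 m w" "d = V1 m' z"
    using assms(1-3) by (auto simp: is_V0_def split: bvertex.splits)
  then show False using assms(4-7) no_four_cycle_V0_V0_V1_V1 by blast
next
  case False
  then obtain x u x' v m w m' z where "a = V0 x u" "b = V1 m w" "c = V1 m' z" "d = V0 x' v"
    using assms(1-3) by (auto simp: is_V0_def split: bvertex.splits)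
  then show False using assms(4-7) no_four_cycle_V0_V0_V1_V1[of x' v x u m w m' z] by blast
qed

lemma four_cycle_alternating:
  assumes "is_V0 a" "\<not> is_V0 b" "is_V0 c" "\<not> is_V0 d"
    "{a, b} \<in> edges B" "{b, c} \<in> edges B" "{c, d} \<in> edges B" "{d, a} \<in> edges B"
  shows "a = c \<or> b = d"
proof -
  obtain x u m w x' v m' z where "a = V0 x u" "b = V1 m w" "c = V0 x' v" "d = V1 m' z"
    using assms(1-4) by (auto simp: is_V0_def split: bvertex.splits)
  then show ?thesis using assms(5-8) four_cycle_V0_V1_V0_V1 by blast
qed

lemma C4_free_B: "C4_free B"
  unfolding C4_free_def
proof (intro allI impI, elim conjE)
  fix a b c d
  assume e: "{a, b} \<in> edges B" "{b, c} \<in> edges B" "{c, d} \<in> edges B" "{d, a} \<in> edges B"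
  \<comment> \<open>Up to rotation the mixed patterns are three against one, two consecutive points,
    and alternation; the instances run through the rotations.\<close>
  consider "is_V0 a" "is_V0 b" "is_V0 c" "is_V0 d"
    | "\<not> is_V0 a" "\<not> is_V0 b" "\<not> is_V0 c" "\<not> is_V0 d" | "a = c \<or> b = d"
    using four_cycle_three_V0[OF _ _ _ _ e] four_cycle_three_V0[OF _ _ _ _ e(2,3,4,1)]
      four_cycle_three_V0[OF _ _ _ _ e(3,4,1,2)] four_cycle_three_V0[OF _ _ _ _ e(4,1,2,3)]
      four_cycle_three_V1[OF _ _ _ _ e] four_cycle_three_V1[OF _ _ _ _ e(2,3,4,1)]
      four_cycle_three_V1[OF _ _ _ _ e(3,4,1,2)] four_cycle_three_V1[OF _ _ _ _ e(4,1,2,3)]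
      four_cycle_two_V0[OF _ _ _ e] four_cycle_two_V0[OF _ _ _ e(2,3,4,1)]
      four_cycle_two_V0[OF _ _ _ e(3,4,1,2)] four_cycle_two_V0[OF _ _ _ e(4,1,2,3)]
      four_cycle_alternating[OF _ _ _ _ e] four_cycle_alternating[OF _ _ _ _ e(2,3,4,1)]
    by argo
  then show "a = c \<or> b = d"
  proof cases
    case 1
    then obtain x u x' v x'' w y z where "a = V0 x u" "b = V0 x' v" "c = V0 x'' w" "d = V0 y z"
      by (auto simp: is_V0_def split: bvertex.splits)
    then show ?thesis
      using e C4_freeD[OF point_graph_free(2)[of x], of u v w z] by (auto simp: edge_V0_V0)
  next
    case 2
    then obtain x u x' v x'' w y z where "a = V1 x u" "b = V1 x' v" "c = V1 x'' w" "d = V1 y z"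
      by (auto simp: is_V0_def split: bvertex.splits)
    then show ?thesis
      using e C4_freeD[OF star_C4_free[OF q n], of u v w z] by (auto simp: edge_V1_V1)
  qed
qed

section \<open>Girth and biregularity\<close>

lemma girth_B: "girth B = 5"
proof (rule girth_eq_5I[OF triangle_free_B C4_free_B])
  \<comment> \<open>Incidence with lines of slope 0 preserves the second coordinate. So the star
    path 2, 0, 2n+3 in line block 0 is closed up by the G_1 edge between 2 and 2n+3 in point block
    1.\<close>
  let ?p = "[V1 0 0, V1 0 2, V0 1 2, V0 1 (2 * n + 3), V1 0 (2 * n + 3)]"
  have "{V1 0 0, V1 0 2} \<in> edges B" "{V1 0 2, V0 1 2} \<in> edges B"
    "{V0 1 2, V0 1 (2 * n + 3)} \<in> edges B" "{V0 1 (2 * n + 3), V1 0 (2 * n + 3)} \<in> edges B"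
    "{V1 0 (2 * n + 3), V1 0 0} \<in> edges B"
  proof -
    have "{0, 2} \<in> edges (star_par q)" "{2 * n + 3, 0} \<in> edges (star_par q)" "2 * n + 3 < q" "2 < q"
      unfolding star_edge_iff[OF q] using q n by simp_all
    moreover have "{2, 2 * n + 3} \<in> edges (G1_par q)"
      unfolding G1_edge_iff[OF q] using q n by simp
    then have "{2, 2 * n + 3} \<in> edges (point_graph 1)" by (simp add: point_graph_def)
    ultimately show "{V1 0 0, V1 0 2} \<in> edges B" "{V1 0 2, V0 1 2} \<in> edges B"
      "{V0 1 2, V0 1 (2 * n + 3)} \<in> edges B" "{V0 1 (2 * n + 3), V1 0 (2 * n + 3)} \<in> edges B"
      "{V1 0 (2 * n + 3), V1 0 0} \<in> edges B"
      using q_pos \<mu>(2)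
      by (simp_all add: edge_V0_V0 edge_V0_V1 edge_V1_V0 edge_V1_V1 V0_in_verts V1_in_verts)
  qed
  moreover from this have "set ?p \<subseteq> verts B"
    using simple_graph_edgeD[OF simple_B] by auto
  ultimately show "is_cycle B ?p"
    by (auto simp: is_cycle_def less_Suc_eq)
qed simp

lemma biregular_B: "biregular_graph (q + 1) (2 * q - 3) 5 B"
proof -
  have "graph_degree B v \<in> {q + 1, 2 * q - 3}" if "v \<in> verts B" for v
    using that degree_V0 degree_V1 by (cases v) auto
  moreover have "V0 1 0 \<in> verts B" "V1 0 0 \<in> verts B"
    using q_pos \<mu>(2) by (simp_all add: V0_in_verts V1_in_verts)
  then have "q + 1 \<in> {graph_degree B v | v. v \<in> verts B}"
    "2 * q - 3 \<in> {graph_degree B v | v. v \<in> verts B}"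
    using degree_V0[of 1 0] degree_V1[of 0 0] by force+
  ultimately have "{graph_degree B v | v. v \<in> verts B} = {q + 1, 2 * q - 3}" by blast
  then show ?thesis
    using simple_B girth_B q n by (simp add: biregular_graph_def numeral_eq_enat)
qed

end

text \<open>The index j takes only the value 2, and a power of the unit \<open>\<alpha>\<close> is
  not divisible by q.\<close>

lemma U_set_1:
  assumes "prime q" "2 < q" "residue_primroot q \<alpha>"
  obtains \<mu> where "U_set q \<alpha> 1 = {\<mu>}" "0 < \<mu>" "\<mu> < q"
proof
  have "{2..1 + 1} = {2 :: nat}" by auto
  then show "U_set q \<alpha> 1 = {\<alpha> ^ (q - 2) mod q}" unfolding U_set_def by (simp only:) simp
  have "coprime q \<alpha>" using assms(3) by (simp add: residue_primroot_def)
  then have "\<not> q dvd \<alpha> ^ (q - 2)"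
    using assms(1) by (metis coprime_absorb_left not_prime_unit prime_dvd_power)
  then show "0 < \<alpha> ^ (q - 2) mod q" by (simp add: mod_greater_zero_iff_not_dvd)
  show "\<alpha> ^ (q - 2) mod q < q" using assms(2) by simp
qed

theorem theorem5p1:
  fixes n q r \<alpha> :: nat and B :: "bvertex sgraph"
  assumes "q = 4 * n + 3" and "prime q" and "n \<ge> 1" and "r = q + 1"
    and "\<alpha> \<in> Zmod q" and "residue_primroot q \<alpha>"
    and "B = B_amalgam q \<alpha> (S_par q) T_par 0 1 (H1_par q) (H2_par q) (G1_par q) (G2_par q)"
  shows "biregular_cage r (2 * r - 5) 5 B \<and> graph_order B = r * (2 * r - 5) + 1"
proof -
  have "2 < q" using assms(1) by simp
  then obtain \<mu> where "U_set q \<alpha> 1 = {\<mu>}" "0 < \<mu>" "\<mu> < q"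
    using U_set_1 assms(2,6) by blast
  then interpret amalgam n q \<alpha> \<mu> B
    using assms by unfold_locales
  have m: "2 * r - 5 = 2 * q - 3" using assms(4) by simp
  have "r * (2 * r - 5) + 1 = 2 * q * q - q - 2"
  proof -
    \<comment> \<open>Writing q as k+3 makes the subtractions exact, so that (q+1)(2q-3)+1 =
      2q^2-q-2 becomes a polynomial identity in k.\<close>
    obtain k where k: "q = k + 3" using assms(1) by simp
    show ?thesis unfolding m assms(4) k by (simp add: algebra_simps)
  qed
  then have order: "graph_order B = r * (2 * r - 5) + 1" using order_B by simp
  moreover have "biregular_graph r (2 * r - 5) 5 B"
    using biregular_B unfolding m by (simp only: assms(4))
  moreover have "graph_order B \<le> graph_order H" if "biregular_graph r (2 * r - 5) 5 H" for H :: "nat sgraph"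
    using biregular_graph_5_order_ge[OF that] order by simp
  ultimately show ?thesis by (simp add: biregular_cage_def)
qed

end
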